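(* Let $G$ be a finite simple connected undirected vertex-transitive graph with $N$ vertices and normalized graph Laplacian $L$, and let $a\ge0$, $q\ge0$, $c>0$. There exist $t_0\in\mathbb{R}_+$ and $x_0\in\mathbb{R}_+$ such that the solution $R(t)$ to the matrix-valued ODE $$R'(t)=\frac1c\,\mathrm{Tr}\left[Q'(R(t))\,e^{-t(a+q)L}\right]e^{-t(a+q)L},\qquad R(0)=0,$$ where $Q(X):=[\det(I+cXL)]^{1/N}$ for $X\in\mathscr{X}$, exists and is unique in $\mathscr{X}$, when $t\in[0,t_0]$ and $0\le R(t)\le x_0I$.
   Context: For a graph $G=(V,E)$ with $V=\{v_1,\dots,v_N\}$ and degrees $d_{v_i}$, the normalized graph Laplacian $L$ is the symmetric $N\times N$ matrix with $L_{ii}=1$, $L_{ij}=-1/\sqrt{d_{v_i}d_{v_j}}$ if $i\neq j$ and $v_i$, $v_j$ are adjacent, $L_{ij}=0$ otherwise. $G$ is vertex-transitive if for any two vertices $u,v$ there is a graph automorphism mapping $u$ to $v$. For symmetric matrices, $A\ge B$ means $A-B$ is positive semi-definite. $\mathscr{X}:=\{X: X\ge0,\ X\text{ is a polynomial of }L\}$, a subset of the real symmetric $N\times N$ matrices. $Q'(X)$ denotes the matrix derivative of $Q$, i.e. $Q'(X)=\frac1N[\det(I+cXL)]^{1/N}(I+cXL)^{-1}cL$ for $X\in\mathscr{X}$. Here $\mathbb{R}_+$ is understood as the positive reals (so the local statement is non-degenerate). *)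

theory Defs
  imports "HOL-Analysis.Analysis" "HOL-Computational_Algebra.Polynomial"
begin

text \<open>
  A finite graph has vertex set the finite type \<open>'n\<close> (so \<open>N = CARD('n)\<close>) and is given by its
  adjacency relation.
\<close>

definition simple_graph :: "('n \<Rightarrow> 'n \<Rightarrow> bool) \<Rightarrow> bool" where
  "simple_graph E \<longleftrightarrow> symp E \<and> irreflp E"

definition graph_connected :: "('n \<Rightarrow> 'n \<Rightarrow> bool) \<Rightarrow> bool" where
  "graph_connected E \<longleftrightarrow> (\<forall>u v. E\<^sup>*\<^sup>* u v)"

definition graph_automorphism :: "('n \<Rightarrow> 'n \<Rightarrow> bool) \<Rightarrow> ('n \<Rightarrow> 'n) \<Rightarrow> bool" where
  "graph_automorphism E f \<longleftrightarrow> bij f \<and> (\<forall>u v. E (f u) (f v) \<longleftrightarrow> E u v)"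

definition vertex_transitive :: "('n \<Rightarrow> 'n \<Rightarrow> bool) \<Rightarrow> bool" where
  "vertex_transitive E \<longleftrightarrow> (\<forall>u v. \<exists>f. graph_automorphism E f \<and> f u = v)"

definition degree_of :: "('n::finite \<Rightarrow> 'n \<Rightarrow> bool) \<Rightarrow> 'n \<Rightarrow> nat" where
  "degree_of E v = card {w. E v w}"

definition normalized_laplacian :: "('n::finite \<Rightarrow> 'n \<Rightarrow> bool) \<Rightarrow> real^'n^'n" where
  "normalized_laplacian E =
     (\<chi> i j. if i = j then 1
            else if E i j then - 1 / sqrt (real (degree_of E i) * real (degree_of E j))
            else 0)"

definition psd :: "real^'n^'n \<Rightarrow> bool" where
  "psd A \<longleftrightarrow> transpose A = A \<and> (\<forall>x. 0 \<le> x \<bullet> (A *v x))"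

text \<open>The Loewner order; the order \<open>\<le>\<close> that the library puts on vectors is the entrywise one.\<close>

definition loewner_le :: "real^'n^'n \<Rightarrow> real^'n^'n \<Rightarrow> bool" where
  "loewner_le A B \<longleftrightarrow> psd (B - A)"

definition mat_pow :: "real^'n^'n \<Rightarrow> nat \<Rightarrow> real^'n^'n" where
  "mat_pow A k = (((**) A) ^^ k) (mat 1)"

definition mat_poly :: "real poly \<Rightarrow> real^'n^'n \<Rightarrow> real^'n^'n" where
  "mat_poly p A = (\<Sum>k\<le>degree p. coeff p k *\<^sub>R mat_pow A k)"

text \<open>
  The matrix exponential; the library's \<open>exp\<close> does not apply, since \<open>real^'n^'n\<close> is not an
  algebra under \<open>(**)\<close>.
\<close>

definition mat_exp :: "real^'n^'n \<Rightarrow> real^'n^'n" where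
  "mat_exp A = (\<Sum>k. (1 / fact k) *\<^sub>R mat_pow A k)"

definition psd_polys :: "real^'n^'n \<Rightarrow> (real^'n^'n) set" where
  "psd_polys L = {X. psd X \<and> (\<exists>p. X = mat_poly p L)}"

text \<open>
  For \<open>X \<in> psd_polys L\<close> with \<open>L\<close> positive semidefinite and \<open>c > 0\<close>, the eigenvalues of
  \<open>mat 1 + c *\<^sub>R (X ** L)\<close> are at least 1, so the power and the inverse below are the genuine ones.
\<close>

definition Q_fun :: "real \<Rightarrow> real^'n^'n \<Rightarrow> real^'n^'n \<Rightarrow> real" where
  "Q_fun c L X = det (mat 1 + c *\<^sub>R (X ** L)) powr (1 / real CARD('n))"

text \<open>The matrix derivative of \<open>Q_fun c L\<close>, by Jacobi's formula.\<close>

definition Q_deriv :: "real \<Rightarrow> real^'n^'n \<Rightarrow> real^'n^'n \<Rightarrow> real^'n^'n" where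
  "Q_deriv c L X =
     (1 / real CARD('n) * Q_fun c L X) *\<^sub>R
       (matrix_inv (mat 1 + c *\<^sub>R (X ** L)) ** (c *\<^sub>R L))"

text \<open>
  Solutions on \<open>[0, t0]\<close> with values in \<open>psd_polys L\<close> and between \<open>0\<close> and \<open>x0 I\<close>; at the endpoints
  the derivative is one-sided. Values of \<open>R\<close> outside \<open>[0, t0]\<close> are irrelevant.
\<close>

definition is_solution ::
  "real^'n^'n \<Rightarrow> real \<Rightarrow> real \<Rightarrow> real \<Rightarrow> real \<Rightarrow> real \<Rightarrow> (real \<Rightarrow> real^'n^'n) \<Rightarrow> bool" where
  "is_solution L a q c t0 x0 R \<longleftrightarrow>
     R 0 = 0 \<and>
     (\<forall>t\<in>{0..t0}.
        R t \<in> psd_polys L \<and> loewner_le 0 (R t) \<and> loewner_le (R t) (x0 *\<^sub>R mat 1) \<and>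
        (R has_vector_derivative
           ((1 / c) * trace (Q_deriv c L (R t) ** mat_exp ((- t * (a + q)) *\<^sub>R L))) *\<^sub>R
             mat_exp ((- t * (a + q)) *\<^sub>R L))
        (at t within {0..t0}))"

end

theory Submission
  imports Defs
begin

text \<open>
  The equation is an ordinary differential equation \<open>R' = F(t, R)\<close> in the finite-dimensional space of
  matrices, started at \<open>R = 0\<close>, and the claim is a local one. The proof is the Picard iteration near
  the origin, with two additional points: the field is given by a formula that is singular at some
  matrices, and the solution has to stay in the cone of positive semidefinite polynomials in \<open>L\<close>.

  The formula causes no trouble at small \<open>X\<close>. There \<open>I + c X L\<close> is close to the identity, so the
  determinant, its root of order \<open>N\<close>, the inverse, and with them \<open>Q'\<close> are Lipschitz
  (\<open>lipschitz_near_Q_deriv\<close>).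

  The cone is preserved because the field is a scalar times the exponential \<open>e\<close> of
  \<open>- t (a + q) L\<close>. At \<open>t = 0\<close>, \<open>X = 0\<close> the scalar is \<open>Tr L / N\<close>, which is 1 for
  the normalized Laplacian, and so it is nonnegative nearby. For small \<open>t\<close> the matrix \<open>e\<close> is
  symmetric and close to the identity, hence positive semidefinite, and as a limit of polynomials in
  \<open>L\<close> it is itself one, since the polynomials in \<open>L\<close> form a finite-dimensional subspace.
  Thus the field points into the closed convex cone \<open>psd_polys L\<close> (\<open>flow_field_near_zero\<close>), and
  integrals of cone-valued functions remain in it (\<open>integral_in_closed_convex_cone\<close>), so the
  iteration can be run inside the cone (\<open>picard_existence\<close>).

  Uniqueness is the usual contraction estimate (\<open>picard_uniqueness\<close>); it applies to all solutions
  between \<open>0\<close> and \<open>x0 I\<close> because these Loewner bounds control the norm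
  (\<open>loewner_interval_norm_bound\<close>). The graph enters through the symmetry of \<open>L\<close> and
  \<open>Tr L = N\<close>.
\<close>

section \<open>Functions that are Lipschitz near a point\<close>

text \<open>
  The radius may shrink from one use to the next, so that products and compositions stay in the
  class without any bookkeeping of domains.
\<close>

definition lipschitz_near :: "('a::metric_space \<Rightarrow> 'b::metric_space) \<Rightarrow> 'a \<Rightarrow> bool" where
  "lipschitz_near f x \<longleftrightarrow> (\<exists>r>0. \<exists>B. B-lipschitz_on (ball x r) f)"

lemma lipschitz_nearI: "r > 0 \<Longrightarrow> B-lipschitz_on (ball x r) f \<Longrightarrow> lipschitz_near f x"
  unfolding lipschitz_near_def by blast

lemma lipschitz_near_const: "lipschitz_near (\<lambda>_. c) x"
  by (rule lipschitz_nearI[OF zero_less_one lipschitz_on_constant])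

lemma lipschitz_near_bounded_linear:
  assumes "bounded_linear f"
  shows "lipschitz_near f x"
  by (rule bounded_linear.lipschitz_boundE[OF assms]) (rule lipschitz_nearI[OF zero_less_one])

lemma lipschitz_near_common_ball:
  assumes "lipschitz_near f x" and "lipschitz_near g x"
  obtains r B C where "r > 0" "B-lipschitz_on (ball x r) f" "C-lipschitz_on (ball x r) g"
proof -
  obtain r B s C where r: "r > 0" and B: "B-lipschitz_on (ball x r) f"
    and s: "s > 0" and C: "C-lipschitz_on (ball x s) g"
    using assms unfolding lipschitz_near_def by blast
  show thesis
  proof (rule that)
    show "min r s > 0" using r s by simp
    show "B-lipschitz_on (ball x (min r s)) f" by (rule lipschitz_on_subset[OF B subset_ball]) simp
    show "C-lipschitz_on (ball x (min r s)) g" by (rule lipschitz_on_subset[OF C subset_ball]) simp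
  qed
qed

lemma lipschitz_near_add:
  fixes f g :: "'a::metric_space \<Rightarrow> 'b::real_normed_vector"
  assumes "lipschitz_near f x" and "lipschitz_near g x"
  shows "lipschitz_near (\<lambda>y. f y + g y) x"
  by (rule lipschitz_near_common_ball[OF assms]) (rule lipschitz_nearI[OF _ lipschitz_on_add])

lemma lipschitz_near_sum:
  fixes f :: "'i \<Rightarrow> 'a::metric_space \<Rightarrow> 'b::real_normed_vector"
  assumes "\<And>i. i \<in> I \<Longrightarrow> lipschitz_near (f i) x"
  shows "lipschitz_near (\<lambda>y. \<Sum>i\<in>I. f i y) x"
  using assms
  by (induction I rule: infinite_finite_induct) (auto intro: lipschitz_near_const lipschitz_near_add)

lemma lipschitz_on_bounded_set_norm_bound:
  fixes f :: "'a::metric_space \<Rightarrow> 'b::real_normed_vector"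
  assumes "B-lipschitz_on S f" and "S \<subseteq> cball x r" and "x \<in> S" and "y \<in> S"
  shows "norm (f y) \<le> norm (f x) + B * r"
proof -
  have "norm (f y - f x) \<le> B * dist y x"
    using lipschitz_onD[OF assms(1,4,3)] by (simp add: dist_norm)
  also have "\<dots> \<le> B * r"
    using assms lipschitz_on_nonneg[OF assms(1)]
    by (intro mult_left_mono) (auto simp: dist_commute)
  finally show ?thesis
    using norm_triangle_ineq2[of "f y" "f x"] by linarith
qed

text \<open>
  A product of Lipschitz functions is Lipschitz only where both factors are bounded; a Lipschitz
  function is bounded on a ball, so the bilinear telescoping
  \<open>h u v - h u' v' = h (u - u') v + h u' (v - v')\<close> gives the estimate.
\<close>

lemma lipschitz_near_bilinear:
  fixes f :: "'a::metric_space \<Rightarrow> 'b::real_normed_vector"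
    and g :: "'a \<Rightarrow> 'c::real_normed_vector"
  assumes "bounded_bilinear h" and "lipschitz_near f x" and "lipschitz_near g x"
  shows "lipschitz_near (\<lambda>y. h (f y) (g y)) x"
proof -
  interpret h: bounded_bilinear h by fact
  obtain K where K: "K > 0" "\<And>u v. norm (h u v) \<le> norm u * norm v * K"
    using h.pos_bounded by blast
  obtain r B C where r: "r > 0" and B: "B-lipschitz_on (ball x r) f"
    and C: "C-lipschitz_on (ball x r) g"
    using lipschitz_near_common_ball assms by blast
  define Mf where "Mf = norm (f x) + B * r"
  define Mg where "Mg = norm (g x) + C * r"
  note nn = lipschitz_on_nonneg[OF B] lipschitz_on_nonneg[OF C]
  have Mf: "norm (f y) \<le> Mf" and Mg: "norm (g y) \<le> Mg" if "y \<in> ball x r" for y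
    using lipschitz_on_bounded_set_norm_bound[OF B ball_subset_cball _ that]
      lipschitz_on_bounded_set_norm_bound[OF C ball_subset_cball _ that] r
    by (auto simp: Mf_def Mg_def)
  have M0: "0 \<le> Mf" "0 \<le> Mg" using nn r by (auto simp: Mf_def Mg_def)
  have "((B * Mg + Mf * C) * K)-lipschitz_on (ball x r) (\<lambda>y. h (f y) (g y))"
  proof (rule lipschitz_onI)
    fix y z assume yz: "y \<in> ball x r" "z \<in> ball x r"
    have "h (f y) (g y) - h (f z) (g z) = h (f y - f z) (g y) + h (f z) (g y - g z)"
      by (simp add: h.diff_left h.diff_right)
    then have "dist (h (f y) (g y)) (h (f z) (g z))
        \<le> norm (h (f y - f z) (g y)) + norm (h (f z) (g y - g z))"
      by (simp add: dist_norm norm_triangle_ineq)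
    also have "\<dots> \<le> norm (f y - f z) * norm (g y) * K + norm (f z) * norm (g y - g z) * K"
      by (intro add_mono K)
    also have "\<dots> \<le> (B * dist y z) * Mg * K + Mf * (C * dist y z) * K"
      using K(1) M0 nn yz Mf Mg lipschitz_onD[OF B yz] lipschitz_onD[OF C yz]
      by (intro add_mono mult_mono) (auto simp: dist_norm)
    finally show "dist (h (f y) (g y)) (h (f z) (g z)) \<le> (B * Mg + Mf * C) * K * dist y z"
      by (simp add: algebra_simps)
  qed (use K M0 nn in auto)
  then show ?thesis using r lipschitz_nearI by blast
qed

lemma lipschitz_near_prod:
  fixes f :: "'i \<Rightarrow> 'a::metric_space \<Rightarrow> real"
  assumes "\<And>i. i \<in> I \<Longrightarrow> lipschitz_near (f i) x"
  shows "lipschitz_near (\<lambda>y. \<Prod>i\<in>I. f i y) x"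
  using assms
  by (induction I rule: infinite_finite_induct)
    (auto intro: lipschitz_near_const lipschitz_near_bilinear[OF bounded_bilinear_mult])

lemma lipschitz_near_compose:
  assumes "lipschitz_near f x" and "lipschitz_near g (f x)"
  shows "lipschitz_near (\<lambda>y. g (f y)) x"
proof -
  obtain r B where r: "r > 0" and B: "B-lipschitz_on (ball x r) f"
    using assms(1) unfolding lipschitz_near_def by blast
  obtain s C where s: "s > 0" and C: "C-lipschitz_on (ball (f x) s) g"
    using assms(2) unfolding lipschitz_near_def by blast
  define d where "d = min r (s / (B + 1))"
  have B0: "0 \<le> B" using lipschitz_on_nonneg[OF B] .
  have "d \<le> s / (B + 1)" by (simp add: d_def)
  then have d: "d > 0" "d \<le> r" "d * (B + 1) \<le> s"
    using r s B0 pos_le_divide_eq[of "B + 1" d s] by (auto simp: d_def)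
  have "f ` ball x d \<subseteq> ball (f x) s"
  proof safe
    fix y assume y: "y \<in> ball x d"
    have "dist (f x) (f y) \<le> B * dist x y"
      using lipschitz_onD[OF B] y d r by auto
    also have "\<dots> \<le> B * d" using y B0 by (intro mult_left_mono) auto
    also have "\<dots> < s" using d by (simp add: algebra_simps)
    finally show "f y \<in> ball (f x) s" by simp
  qed
  then have "(C * B)-lipschitz_on (ball x d) (\<lambda>y. g (f y))"
    using B C d by (intro lipschitz_on_compose2) (auto intro: lipschitz_on_subset)
  then show ?thesis using d(1) lipschitz_nearI by blast
qed

text \<open>
  Near 1 the derivative is continuous, hence bounded on a compact ball that avoids 0; the mean value
  theorem does the rest.
\<close>

lemma lipschitz_near_powr: "lipschitz_near (\<lambda>x. x powr s) 1" for s :: real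
proof -
  have pos: "z > 0" if "z \<in> cball 1 (1/2)" for z :: real
    using that by (auto simp: dist_real_def abs_if split: if_splits)
  have "bounded ((\<lambda>z. s * z powr (s - 1)) ` cball 1 (1/2::real))"
    using pos by (intro compact_imp_bounded compact_continuous_image continuous_intros)
      (auto dest: pos)
  then obtain B where B: "B > 0" "\<And>z. z \<in> cball 1 (1/2) \<Longrightarrow> norm (s * z powr (s - 1)) \<le> B"
    unfolding bounded_pos by auto
  have "((\<lambda>x. x powr s) has_field_derivative s * z powr (s - 1)) (at z within cball 1 (1/2))"
    if "z \<in> cball 1 (1/2)" for z
    using pos[OF that] by (auto intro!: derivative_eq_intros simp: powr_diff)
  then have "norm (x powr s - y powr s) \<le> B * norm (x - y)"
    if "x \<in> cball 1 (1/2)" "y \<in> cball 1 (1/2)" for x y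
    using B that
    by (intro field_differentiable_bound[where S = "cball 1 (1/2)" and f' = "\<lambda>z. s * z powr (s - 1)"])
      auto
  then have "B-lipschitz_on (ball 1 (1/2)) (\<lambda>x. x powr s)"
    using B(1) by (intro lipschitz_onI) (auto simp: dist_norm)
  then show ?thesis by (intro lipschitz_nearI[of "1/2"]) auto
qed

lemma lipschitz_near_imp_isCont:
  assumes "lipschitz_near f x"
  shows "isCont f x"
proof -
  obtain r B where r: "r > 0" and B: "B-lipschitz_on (ball x r) f"
    using assms unfolding lipschitz_near_def by blast
  from lipschitz_on_continuous_on[OF B] r show ?thesis
    by (simp add: continuous_on_eq_continuous_at)
qed

section \<open>Lipschitz estimates for the determinant and the inverse near the identity\<close>

lemma bounded_bilinear_matrix_mult:
  "bounded_bilinear ((**) :: real^'m^'n \<Rightarrow> real^'k^'m \<Rightarrow> real^'k^'n)"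
proof -
  have "bilinear ((**) :: real^'m^'n \<Rightarrow> real^'k^'m \<Rightarrow> real^'k^'n)"
    unfolding bilinear_def
    by (auto intro!: linearI simp: matrix_add_ldistrib matrix_scalar_ac scalar_matrix_assoc
        matrix_matrix_mult_def vec_eq_iff sum.distrib algebra_simps sum_distrib_left)
  then show ?thesis by (simp add: bilinear_conv_bounded_bilinear)
qed

lemma bounded_linear_trace: "bounded_linear (trace :: real^'n^'n \<Rightarrow> real)"
  by (subst linear_conv_bounded_linear[symmetric])
    (auto intro!: linearI simp: trace_def sum.distrib sum_distrib_left)

lemma bounded_bilinear_trace_mult:
  "bounded_bilinear (\<lambda>(A :: real^'m^'n) (B :: real^'n^'m). trace (A ** B))"
proof -
  interpret m: bounded_bilinear "(**) :: real^'m^'n \<Rightarrow> real^'n^'m \<Rightarrow> real^'n^'n"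
    by (rule bounded_bilinear_matrix_mult)
  interpret t: bounded_linear "trace :: real^'n^'n \<Rightarrow> real" by (rule bounded_linear_trace)
  have "bilinear (\<lambda>(A :: real^'m^'n) (B :: real^'n^'m). trace (A ** B))"
    unfolding bilinear_def
    by (auto intro!: linearI
        simp: m.add_left m.add_right m.scaleR_left m.scaleR_right t.add t.scaleR)
  then show ?thesis by (simp add: bilinear_conv_bounded_bilinear)
qed

lemma lipschitz_near_det: "lipschitz_near (det :: real^'n^'n \<Rightarrow> real) A"
proof -
  have entry: "bounded_linear (\<lambda>A::real^'n^'n. A $ i $ j)" for i j
    by (intro bounded_linear_compose[OF bounded_linear_vec_nth] bounded_linear_vec_nth)
  show ?thesis
    unfolding det_def
    by (rule lipschitz_near_sum, rule lipschitz_near_bilinear[OF bounded_bilinear_mult],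
        rule lipschitz_near_const, rule lipschitz_near_prod,
        rule lipschitz_near_bounded_linear[OF entry])
qed

lemma matrix_inv_inverse_if_det_nonzero:
  fixes A :: "real^'n^'n" assumes "det A \<noteq> 0" 
  shows "A ** matrix_inv A = mat 1" "matrix_inv A ** A = mat 1"
proof -
  have "\<exists>A'. A ** A' = mat 1 \<and> A' ** A = mat 1"
    using assms invertible_det_nz[of A] unfolding invertible_def by blast
  from someI_ex[OF this] show "A ** matrix_inv A = mat 1" "matrix_inv A ** A = mat 1"
    unfolding matrix_inv_def by auto
qed

text \<open>
  Near the identity the inverses are uniformly bounded: \<open>Z = I - (A - I) Z\<close> with the factor
  \<open>A - I\<close> small forces \<open>norm Z \<le> 2 * norm I\<close>. The Lipschitz estimate then follows from
  the resolvent identity \<open>A\<inverse> - B\<inverse> = A\<inverse> (B - A) B\<inverse>\<close>. Invertibility near the identity comes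
  from the continuity of the determinant.
\<close>

lemma lipschitz_near_matrix_inv: "lipschitz_near (matrix_inv :: real^'n^'n \<Rightarrow> real^'n^'n) (mat 1)"
proof -
  let ?I = "mat 1 :: real^'n^'n"
  interpret m: bounded_bilinear "(**) :: real^'n^'n \<Rightarrow> real^'n^'n \<Rightarrow> real^'n^'n"
    by (rule bounded_bilinear_matrix_mult)
  obtain K where K: "K > 0" "\<And>(A :: real^'n^'n) (B :: real^'n^'n). norm (A ** B) \<le> norm A * norm B * K"
    using m.pos_bounded by blast
  have "isCont det ?I"
    by (rule lipschitz_near_imp_isCont[OF lipschitz_near_det])
  then obtain d where d: "d > 0" "\<And>A :: real^'n^'n. dist A ?I < d \<Longrightarrow> dist (det A) (det ?I) < 1"
    unfolding continuous_at_eps_delta by (auto dest: spec[of _ 1])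
  \<comment> \<open>\<open>K\<close> is the submultiplicativity constant of the norm; the second bound makes \<open>(A - I) Z\<close>
    at most half of \<open>Z\<close>.\<close>
  define r where "r = min d (1 / (2 * K))"
  have r: "r > 0" "r * K \<le> 1/2" using d K by (auto simp: r_def min_def field_simps)
  have inv: "A ** matrix_inv A = ?I" "matrix_inv A ** A = ?I" if "A \<in> ball ?I r" for A
  proof -
    have "dist (det A) (det ?I) < 1" using that by (intro d) (auto simp: r_def dist_commute)
    then have "det A \<noteq> 0" by (auto simp: dist_real_def)
    then show "A ** matrix_inv A = ?I" "matrix_inv A ** A = ?I" by (rule matrix_inv_inverse_if_det_nonzero)+
  qed
  have bound: "norm (matrix_inv A) \<le> 2 * norm ?I" if A: "A \<in> ball ?I r" for A
  proof -
    have "matrix_inv A = ?I - (A - ?I) ** matrix_inv A"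
      by (simp add: m.diff_left inv[OF A])
    then have "norm (matrix_inv A) \<le> norm ?I + norm ((A - ?I) ** matrix_inv A)"
      using norm_triangle_ineq4 by metis
    also have "norm ((A - ?I) ** matrix_inv A) \<le> (norm (A - ?I) * K) * norm (matrix_inv A)"
      using K(2)[of "A - ?I" "matrix_inv A"] by (simp add: mult_ac)
    also have "\<dots> \<le> (r * K) * norm (matrix_inv A)"
      using A K(1) by (intro mult_right_mono) (auto simp: dist_norm norm_minus_commute)
    also have "\<dots> \<le> 1/2 * norm (matrix_inv A)" by (intro mult_right_mono r) auto
    finally show ?thesis by simp
  qed
  have "(4 * (norm ?I)\<^sup>2 * K\<^sup>2)-lipschitz_on (ball ?I r) matrix_inv"
  proof (rule lipschitz_onI)
    fix A B assume AB: "A \<in> ball ?I r" "B \<in> ball ?I r"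
    have "matrix_inv A - matrix_inv B = matrix_inv A ** ((B - A) ** matrix_inv B)"
      by (simp add: m.diff_left m.diff_right inv[OF AB(1)] inv[OF AB(2)] matrix_mul_assoc)
    then have "dist (matrix_inv A) (matrix_inv B)
        \<le> norm (matrix_inv A) * norm ((B - A) ** matrix_inv B) * K"
      using K(2) by (metis dist_norm)
    also have "\<dots> \<le> (2 * norm ?I) * (norm (B - A) * (2 * norm ?I) * K) * K"
      using K(1) by (intro mult_mono order_trans[OF K(2)] bound AB) auto
    finally show "dist (matrix_inv A) (matrix_inv B) \<le> 4 * (norm ?I)\<^sup>2 * K\<^sup>2 * dist A B"
      by (simp add: dist_norm norm_minus_commute power2_eq_square mult_ac)
  qed auto
  then show ?thesis using r(1) lipschitz_nearI by blast
qed

text \<open>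
  At \<open>X = 0\<close> the matrix \<open>I + c X L\<close> is the identity, where the determinant, the root of its
  value 1, and the inverse are all Lipschitz.
\<close>

lemma lipschitz_near_Q_deriv: "lipschitz_near (Q_deriv c L) 0"
proof -
  define M where "M X = mat 1 + c *\<^sub>R (X ** L)" for X
  have M0: "M 0 = mat 1" by (simp add: M_def)
  have "bounded_linear (\<lambda>X. c *\<^sub>R (X ** L))"
    by (rule bounded_linear_compose[OF bounded_linear_scaleR_right
          bounded_bilinear.bounded_linear_left[OF bounded_bilinear_matrix_mult]])
  then have M: "lipschitz_near M 0"
    unfolding M_def
    by (rule lipschitz_near_add[OF lipschitz_near_const lipschitz_near_bounded_linear])
  have "lipschitz_near (\<lambda>X. det (M X)) 0"
    by (rule lipschitz_near_compose[OF M lipschitz_near_det])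
  then have Q: "lipschitz_near (Q_fun c L) 0"
    unfolding Q_fun_def M_def[symmetric]
    by (rule lipschitz_near_compose) (simp only: M0 det_I lipschitz_near_powr)
  have I: "lipschitz_near (\<lambda>X. matrix_inv (M X)) 0"
    by (rule lipschitz_near_compose[OF M]) (simp only: M0 lipschitz_near_matrix_inv)
  show ?thesis
    unfolding Q_deriv_def M_def[symmetric]
    by (rule lipschitz_near_bilinear[OF bounded_bilinear_scaleR
          lipschitz_near_bilinear[OF bounded_bilinear_mult lipschitz_near_const Q]
          lipschitz_near_bilinear[OF bounded_bilinear_matrix_mult I lipschitz_near_const]])
qed

lemma Q_deriv_0: "Q_deriv c L 0 = (c / real CARD('n)) *\<^sub>R L" for L :: "real^'n^'n"
proof -
  have "matrix_inv (mat 1 :: real^'n^'n) = mat 1"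
    using matrix_inv_inverse_if_det_nonzero(1)[of "mat 1 :: real^'n^'n"] by simp
  then show ?thesis by (simp add: Q_deriv_def Q_fun_def)
qed

section \<open>Picard iteration in a closed set\<close>

text \<open>
  The iteration is confined to functions with values in the closed set \<open>K\<close>, so that the field
  has to be Lipschitz on \<open>K\<close> only and the fixed point keeps every property that defines
  \<open>K\<close>. It runs in the complete space of bounded continuous functions on the whole line; an
  integral defined on \<open>{0..T}\<close> is extended by constants on either side (this is what \<open>clamp\<close>
  does), and in the sup metric the integral operator then contracts by the factor \<open>T * B\<close>.
\<close>

lemma picard_existence:
  fixes F :: "real \<Rightarrow> 'a::banach \<Rightarrow> 'a"
  assumes T: "0 \<le> T" "T * B < 1" and K: "closed K" "0 \<in> K"
    and cont: "continuous_on ({0..T} \<times> K) (\<lambda>(t, x). F t x)"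
    and lip: "\<And>t. t \<in> {0..T} \<Longrightarrow> B-lipschitz_on K (F t)"
    and inv: "\<And>\<phi> t. continuous_on {0..T} \<phi> \<Longrightarrow> \<phi> ` {0..T} \<subseteq> K \<Longrightarrow> t \<in> {0..T} \<Longrightarrow>
                integral {0..t} (\<lambda>s. F s (\<phi> s)) \<in> K"
  shows "\<exists>\<phi>. \<phi> 0 = 0 \<and> \<phi> ` {0..T} \<subseteq> K \<and>
           (\<forall>t\<in>{0..T}. (\<phi> has_vector_derivative F t (\<phi> t)) (at t within {0..T}))"
proof -
  define S where "S = (PiC UNIV (\<lambda>_. K) :: (real \<Rightarrow>\<^sub>C 'a) set)"
  define J where "J \<phi> t = integral {0..t} (\<lambda>s. F s (\<phi> s))" for \<phi> t
  have B0: "0 \<le> B" using lip[of 0] T(1) lipschitz_on_nonneg by auto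
  have S: "apply_bcontfun \<phi> t \<in> K" if "\<phi> \<in> S" for \<phi> t
    using that by (auto simp: S_def mem_PiC_iff)
  have contF: "continuous_on {0..T} (\<lambda>s. F s (\<phi> s))"
    if "continuous_on {0..T} \<phi>" "\<phi> ` {0..T} \<subseteq> K" for \<phi>
  proof -
    have "continuous_on {0..T} (\<lambda>s. (s, \<phi> s))" using that(1) by (intro continuous_intros)
    from continuous_on_compose2[OF cont this] that(2) show ?thesis by auto
  qed
  have contS: "continuous_on {0..T} (\<lambda>s. F s (apply_bcontfun \<phi> s))" if "\<phi> \<in> S" for \<phi>
    using contF[of "apply_bcontfun \<phi>"] S[OF that] by auto
  have clamp: "clamp 0 T t \<in> {0..T}" for t
    using clamp_in_interval[of 0 T t] T(1) by (simp add: cbox_interval)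
  have "\<forall>\<phi>\<in>S. \<exists>\<psi>. \<forall>t. apply_bcontfun \<psi> t = J \<phi> (clamp 0 T t)"
  proof
    fix \<phi> assume \<phi>: "\<phi> \<in> S"
    have "continuous_on {0..T} (J \<phi>)"
      unfolding J_def by (intro indefinite_integral_continuous_1 integrable_continuous_real contS \<phi>)
    then have "continuous_on (cbox 0 T) (J \<phi>)" by (simp add: cbox_interval)
    from continuous_on_cbox_bcontfunE[OF this]
    show "\<exists>\<psi>. \<forall>t. apply_bcontfun \<psi> t = J \<phi> (clamp 0 T t)" by metis
  qed
  then obtain P where P: "\<And>\<phi> t. \<phi> \<in> S \<Longrightarrow> apply_bcontfun (P \<phi>) t = J \<phi> (clamp 0 T t)"
    by (auto dest!: bchoice)
  have "\<exists>!\<phi>\<in>S. P \<phi> = \<phi>"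
  proof (rule Banach_fix)
    show "complete S"
      unfolding S_def by (simp add: complete_eq_closed closed_PiC K)
    have "const_bcontfun 0 \<in> S" by (simp add: S_def mem_PiC_iff const_bcontfun.rep_eq K)
    then show "S \<noteq> {}" by blast
    show "0 \<le> T * B" "T * B < 1" using T B0 by auto
    show "P ` S \<subseteq> S"
    proof safe
      fix \<phi> assume \<phi>: "\<phi> \<in> S"
      have "J \<phi> (clamp 0 T t) \<in> K" for t
        unfolding J_def using S[OF \<phi>] clamp by (intro inv) auto
      then show "P \<phi> \<in> S" by (auto simp: S_def mem_PiC_iff P[OF \<phi>])
    qed
    fix \<phi> \<psi> assume \<phi>: "\<phi> \<in> S" and \<psi>: "\<psi> \<in> S"
    have "dist (J \<phi> t) (J \<psi> t) \<le> T * B * dist \<phi> \<psi>" if t: "t \<in> {0..T}" for t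
    proof -
      have c: "continuous_on {0..t} (\<lambda>s. F s (apply_bcontfun \<phi> s))"
        "continuous_on {0..t} (\<lambda>s. F s (apply_bcontfun \<psi> s))"
        using contS[OF \<phi>] contS[OF \<psi>] t by (auto elim: continuous_on_subset)
      have "J \<phi> t - J \<psi> t =
          integral {0..t} (\<lambda>s. F s (apply_bcontfun \<phi> s) - F s (apply_bcontfun \<psi> s))"
        unfolding J_def using c by (intro integral_diff[symmetric] integrable_continuous_real)
      moreover have "norm (F s (apply_bcontfun \<phi> s) - F s (apply_bcontfun \<psi> s)) \<le> B * dist \<phi> \<psi>"
        if "s \<in> {0..t}" for s
      proof -
        have "norm (F s (apply_bcontfun \<phi> s) - F s (apply_bcontfun \<psi> s))
            \<le> B * dist (apply_bcontfun \<phi> s) (apply_bcontfun \<psi> s)"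
          using lipschitz_onD[OF lip[of s], of "apply_bcontfun \<phi> s" "apply_bcontfun \<psi> s"]
            S \<phi> \<psi> that t
          by (auto simp: dist_norm)
        also have "\<dots> \<le> B * dist \<phi> \<psi>" by (intro mult_left_mono dist_bounded B0)
        finally show ?thesis .
      qed
      ultimately have "dist (J \<phi> t) (J \<psi> t) \<le> (B * dist \<phi> \<psi>) * (t - 0)"
        using t c unfolding dist_norm by (auto intro!: integral_bound[of 0 t, simplified] continuous_intros)
      also have "\<dots> \<le> (B * dist \<phi> \<psi>) * T"
        using t B0 by (intro mult_left_mono) auto
      finally show ?thesis by (simp add: mult_ac)
    qed
    then show "dist (P \<phi>) (P \<psi>) \<le> T * B * dist \<phi> \<psi>"
      using clamp by (intro dist_bound) (auto simp: P[OF \<phi>] P[OF \<psi>])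
  qed
  then obtain \<phi> where \<phi>: "\<phi> \<in> S" "P \<phi> = \<phi>" by blast
  have fix_eq: "apply_bcontfun \<phi> t = J \<phi> t" if "t \<in> {0..T}" for t
    using P[OF \<phi>(1), of t] \<phi>(2) that clamp_cancel_cbox[of t 0 T] by (simp add: cbox_interval)
  have "(apply_bcontfun \<phi> has_vector_derivative F t (apply_bcontfun \<phi> t)) (at t within {0..T})"
    if "t \<in> {0..T}" for t
  proof (rule has_vector_derivative_transform[OF that])
    show "(J \<phi> has_vector_derivative F t (apply_bcontfun \<phi> t)) (at t within {0..T})"
      unfolding J_def by (rule integral_has_vector_derivative[OF contS[OF \<phi>(1)] that])
  qed (simp add: fix_eq)
  moreover have "apply_bcontfun \<phi> 0 = 0" using fix_eq[of 0] T(1) by (simp add: J_def)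
  ultimately show ?thesis using S[OF \<phi>(1)] by blast
qed

text \<open>
  If \<open>d\<close> is the maximal distance of two solutions, their derivatives differ by at most
  \<open>B * d\<close>, so \<open>d \<le> T * B * d\<close> by the mean value inequality, and \<open>d = 0\<close>. The set
  \<open>K\<close> may be larger than the one in which a solution is constructed.
\<close>

lemma picard_uniqueness:
  fixes F :: "real \<Rightarrow> 'a::real_normed_vector \<Rightarrow> 'a"
  assumes T: "0 \<le> T" "T * B < 1"
    and lip: "\<And>t. t \<in> {0..T} \<Longrightarrow> B-lipschitz_on K (F t)"
    and init: "\<phi> 0 = \<psi> 0"
    and \<phi>: "\<And>t. t \<in> {0..T} \<Longrightarrow> \<phi> t \<in> K \<and>
              (\<phi> has_vector_derivative F t (\<phi> t)) (at t within {0..T})"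
    and \<psi>: "\<And>t. t \<in> {0..T} \<Longrightarrow> \<psi> t \<in> K \<and>
              (\<psi> has_vector_derivative F t (\<psi> t)) (at t within {0..T})"
    and t: "t \<in> {0..T}"
  shows "\<phi> t = \<psi> t"
proof -
  define \<delta> where "\<delta> t = \<phi> t - \<psi> t" for t
  have B0: "0 \<le> B" using lip[of 0] T(1) lipschitz_on_nonneg by auto
  have der: "(\<delta> has_vector_derivative F t (\<phi> t) - F t (\<psi> t)) (at t within {0..T})"
    if "t \<in> {0..T}" for t
    unfolding \<delta>_def using \<phi>[OF that] \<psi>[OF that] by (auto intro: has_vector_derivative_diff)
  then have "continuous_on {0..T} \<delta>"
    by (intro continuous_on_vector_derivative)
  then have "continuous_on {0..T} (\<lambda>t. norm (\<delta> t))" by (rule continuous_on_norm)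
  then obtain m where m: "m \<in> {0..T}" "\<And>t. t \<in> {0..T} \<Longrightarrow> norm (\<delta> t) \<le> norm (\<delta> m)"
    using continuous_attains_sup[of "{0..T}" "\<lambda>t. norm (\<delta> t)"] T(1) by auto
  have "norm (\<delta> m - \<delta> 0) \<le> (B * norm (\<delta> m)) * norm (m - 0)"
  proof (rule differentiable_bound[OF convex_real_interval(5)])
    fix s assume s: "s \<in> {0..T}"
    show "(\<delta> has_derivative (\<lambda>h. h *\<^sub>R (F s (\<phi> s) - F s (\<psi> s)))) (at s within {0..T})"
      using der[OF s] by (simp add: has_vector_derivative_def)
    have "norm (F s (\<phi> s) - F s (\<psi> s)) \<le> B * norm (\<delta> s)"
      using lipschitz_onD[OF lip[OF s]] \<phi>[OF s] \<psi>[OF s] by (auto simp: dist_norm \<delta>_def)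
    also have "\<dots> \<le> B * norm (\<delta> m)" by (intro mult_left_mono m s B0)
    finally show "onorm (\<lambda>h. h *\<^sub>R (F s (\<phi> s) - F s (\<psi> s))) \<le> B * norm (\<delta> m)"
      by (simp add: onorm_scaleR_left[OF bounded_linear_ident] onorm_id)
  qed (use m T in auto)
  also have "\<dots> \<le> (B * norm (\<delta> m)) * T" using m B0 by (intro mult_left_mono) auto
  finally have "norm (\<delta> m) \<le> (T * B) * norm (\<delta> m)"
    using init by (simp add: \<delta>_def mult_ac)
  then have "norm (\<delta> m) \<le> 0"
    using T(2) mult_strict_right_mono[of "T * B" 1 "norm (\<delta> m)"]
    by (cases "norm (\<delta> m) = 0") auto
  then show ?thesis using m(2)[OF t] by (simp add: \<delta>_def)
qed

text \<open>
  A point outside a closed convex cone is separated from it by a linear functional that is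
  nonnegative on the cone and negative at the point; the functional commutes with the integral.
\<close>

lemma integral_in_closed_convex_cone:
  fixes f :: "'a::euclidean_space \<Rightarrow> 'b::euclidean_space"
  assumes C: "convex_cone C" "closed C" and f: "f integrable_on A" "\<And>s. s \<in> A \<Longrightarrow> f s \<in> C"
  shows "integral A f \<in> C"
proof (rule ccontr)
  assume "integral A f \<notin> C"
  moreover have "convex C" "conic C" "C \<noteq> {}" using C(1) by (auto simp: convex_cone_def)
  ultimately obtain a b where ab: "a \<bullet> integral A f < b" "\<And>x. x \<in> C \<Longrightarrow> b < a \<bullet> x"
    using separating_hyperplane_closed_point[of C "integral A f"] C(2) by blast
  have "b < 0" using ab(2)[of 0] conic_contains_0[OF \<open>conic C\<close>] \<open>C \<noteq> {}\<close> by simp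
  have nonneg: "0 \<le> a \<bullet> x" if x: "x \<in> C" for x
  proof (rule ccontr)
    assume neg: "\<not> 0 \<le> a \<bullet> x"
    then have "(b / (a \<bullet> x)) *\<^sub>R x \<in> C"
      using x \<open>conic C\<close> \<open>b < 0\<close> by (intro conicD) (auto simp: divide_nonpos_nonpos)
    from ab(2)[OF this] show False using neg by simp
  qed
  have "((\<lambda>s. a \<bullet> f s) has_integral a \<bullet> integral A f) A"
    using has_integral_linear[OF integrable_integral[OF f(1)] bounded_linear_inner_right[of a]]
    by (simp add: o_def)
  then have "0 \<le> a \<bullet> integral A f"
    by (rule has_integral_nonneg) (auto intro: nonneg f)
  then show False using ab(1) \<open>b < 0\<close> by simp
qed

section \<open>The cone of positive semidefinite polynomials in a matrix\<close>

lemma norm_matrix_vector_mult_le: "norm (A *v x) \<le> norm A * norm x" for A :: "real^'m^'n"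
proof -
  have "norm (A *v x) \<le> L2_set (\<lambda>i. norm (A $ i) * norm x) UNIV"
    unfolding norm_vec_def[of "A *v x"]
    by (rule L2_set_mono) (auto simp: matrix_mult_dot Cauchy_Schwarz_ineq2)
  then show ?thesis
    by (simp add: L2_set_left_distrib[symmetric] norm_vec_def[of A])
qed

text \<open>
  The perturbation changes the quadratic form \<open>s * (norm x)\<^sup>2\<close> by at most the same amount. With
  \<open>s = 1\<close> this applies to the exponential for small times, and with \<open>s = x0\<close> it turns a
  norm bound \<open>norm X \<le> x0\<close> into the Loewner bound \<open>X \<le> x0 I\<close>.
\<close>

lemma psd_near_scaled_identity:
  fixes A :: "real^'n^'n"
  assumes "transpose A = A" and near: "norm (A - s *\<^sub>R mat 1) \<le> s"
  shows "psd A"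
  unfolding psd_def
proof (intro conjI allI assms(1))
  fix x :: "real^'n"
  have "A *v x = s *\<^sub>R x + (A - s *\<^sub>R mat 1) *v x"
    by (simp add: matrix_vector_mult_diff_rdistrib scaleR_matrix_vector_assoc[symmetric])
  then have "x \<bullet> (A *v x) = s * (norm x)\<^sup>2 + x \<bullet> ((A - s *\<^sub>R mat 1) *v x)"
    by (simp add: inner_add_right power2_norm_eq_inner)
  moreover have "\<bar>x \<bullet> ((A - s *\<^sub>R mat 1) *v x)\<bar> \<le> norm x * norm ((A - s *\<^sub>R mat 1) *v x)"
    by (rule Cauchy_Schwarz_ineq2)
  moreover have "\<dots> \<le> norm x * (s * norm x)"
    by (intro mult_left_mono order_trans[OF norm_matrix_vector_mult_le] mult_right_mono near) auto
  ultimately show "0 \<le> x \<bullet> (A *v x)" by (simp add: power2_eq_square mult_ac)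
qed

text \<open>
  Testing the quadratic form on basis vectors bounds the diagonal by \<open>s\<close>, and testing it on sums
  and differences of two basis vectors bounds every other entry by a mean of diagonal ones.
\<close>

lemma loewner_interval_norm_bound:
  fixes X :: "real^'n^'n"
  assumes "loewner_le 0 X" and "loewner_le X (s *\<^sub>R mat 1)"
  shows "norm X \<le> (real CARD('n))\<^sup>2 * s"
proof -
  have psd: "psd X" "psd (s *\<^sub>R mat 1 - X)" using assms by (auto simp: loewner_le_def)
  have entry: "axis i 1 \<bullet> (A *v axis j 1) = A $ i $ j" for A :: "real^'n^'n" and i j
    by (simp add: matrix_vector_mult_basis column_def inner_axis')
  have sym: "X $ j $ i = X $ i $ j" for i j
    using psd(1) unfolding psd_def by (metis transpose_def vec_lambda_beta)
  have bound: "\<bar>X $ i $ j\<bar> \<le> s" for i j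
  proof -
    have diag: "X $ k $ k \<le> s" for k
    proof -
      have "0 \<le> axis k 1 \<bullet> ((s *\<^sub>R mat 1 - X) *v axis k 1)"
        using psd(2) unfolding psd_def by blast
      then show ?thesis unfolding entry by (simp add: mat_def)
    qed
    have "0 \<le> (axis i 1 + axis j 1) \<bullet> (X *v (axis i 1 + axis j 1))"
      "0 \<le> (axis i 1 - axis j 1) \<bullet> (X *v (axis i 1 - axis j 1))"
      using psd(1) unfolding psd_def by blast+
    then have "0 \<le> X $ i $ i + X $ j $ j + 2 * X $ i $ j" "2 * X $ i $ j \<le> X $ i $ i + X $ j $ j"
      using sym[of j i]
      by (simp_all add: inner_add_left inner_diff_left inner_add_right inner_diff_right
          matrix_vector_right_distrib matrix_vector_mult_diff_distrib entry)
    then show ?thesis using diag[of i] diag[of j] by linarith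
  qed
  have "norm (X $ i) \<le> real CARD('n) * s" for i
    using order_trans[OF norm_le_l1_cart sum_bounded_above[of UNIV "\<lambda>j. \<bar>X $ i $ j\<bar>" s]] bound
    by simp
  then have "(\<Sum>i\<in>UNIV. norm (X $ i)) \<le> real CARD('n) * (real CARD('n) * s)"
    using sum_bounded_above[of UNIV "\<lambda>i. norm (X $ i)" "real CARD('n) * s"] by simp
  moreover have "norm X \<le> (\<Sum>i\<in>UNIV. norm (X $ i))"
    unfolding norm_vec_def[of X] by (rule L2_set_le_sum) simp
  ultimately show ?thesis by (simp add: power2_eq_square)
qed

lemma mat_poly_eq_sum:
  assumes "degree p \<le> n"
  shows "mat_poly p A = (\<Sum>k\<le>n. coeff p k *\<^sub>R mat_pow A k)"
  unfolding mat_poly_def using assms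
  by (intro sum.mono_neutral_left) (auto simp: not_le coeff_eq_0)

lemma subspace_range_mat_poly: "subspace (range (\<lambda>p. mat_poly p A))"
  unfolding subspace_def
proof (intro conjI ballI allI)
  have "mat_poly 0 A = 0" by (simp add: mat_poly_def)
  then show "0 \<in> range (\<lambda>p. mat_poly p A)" by (metis rangeI)
  fix X assume "X \<in> range (\<lambda>p. mat_poly p A)"
  then obtain p where p: "X = mat_poly p A" by blast
  {
    fix Y assume "Y \<in> range (\<lambda>p. mat_poly p A)"
    then obtain q where q: "Y = mat_poly q A" by blast
    define n where "n = max (degree p) (degree q)"
    have "degree p \<le> n" "degree q \<le> n" "degree (p + q) \<le> n"
      by (auto simp: n_def degree_add_le)
    then have "X + Y = mat_poly (p + q) A"
      by (simp add: p q mat_poly_eq_sum sum.distrib scaleR_add_left)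
    then show "X + Y \<in> range (\<lambda>p. mat_poly p A)" by blast
  }
  fix c
  have "c *\<^sub>R X = mat_poly (smult c p) A"
    using mat_poly_eq_sum[OF degree_smult_le, of c p A]
    by (simp add: p mat_poly_def scaleR_sum_right)
  then show "c *\<^sub>R X \<in> range (\<lambda>p. mat_poly p A)" by blast
qed

lemma mat_pow_in_range_mat_poly: "mat_pow A k \<in> range (\<lambda>p. mat_poly p A)"
proof -
  have "mat_poly (monom 1 k) A = mat_pow A k"
    by (simp add: mat_poly_def degree_monom_eq if_distrib[of "\<lambda>c. c *\<^sub>R _"] cong: if_cong)
  then show ?thesis by (metis rangeI)
qed

lemma psd_polys_eq: "psd_polys A = {X. psd X} \<inter> range (\<lambda>p. mat_poly p A)"
  by (auto simp: psd_polys_def)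

lemma linear_transpose: "linear (transpose :: real^'m^'n \<Rightarrow> real^'n^'m)"
  by (auto intro!: linearI simp: transpose_def vec_eq_iff)

lemma convex_cone_psd: "convex_cone {X :: real^'n^'n. psd X}"
  unfolding convex_cone_iff psd_def
  by (auto simp: linear_add[OF linear_transpose] transpose_scalar
      linear_0[OF linear_transpose] matrix_vector_mult_add_rdistrib inner_add_right
      scaleR_matrix_vector_assoc[symmetric])

lemma closed_psd: "closed {X :: real^'n^'n. psd X}"
proof -
  have "linear (\<lambda>X :: real^'n^'n. X *v x)" for x
    by (auto intro!: linearI simp: matrix_vector_mult_add_rdistrib scaleR_matrix_vector_assoc)
  then have quad: "continuous_on UNIV (\<lambda>X :: real^'n^'n. x \<bullet> (X *v x))" for x
    by (intro continuous_on_inner continuous_on_const linear_continuous_on)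
      (simp add: linear_conv_bounded_linear)
  have "continuous_on UNIV (transpose :: real^'n^'n \<Rightarrow> real^'n^'n)"
    using linear_transpose by (intro linear_continuous_on) (simp add: linear_conv_bounded_linear)
  then have "closed {X :: real^'n^'n. transpose X = X}"
    by (intro closed_Collect_eq continuous_on_id)
  moreover have "closed {X :: real^'n^'n. \<forall>x. 0 \<le> x \<bullet> (X *v x)}"
    by (intro closed_Collect_all closed_Collect_le continuous_on_const quad)
  ultimately show ?thesis
    unfolding psd_def Collect_conj_eq by (rule closed_Int)
qed

lemma convex_cone_psd_polys: "convex_cone (psd_polys A)"
  using convex_cone_psd subspace_range_mat_poly[of A]
  unfolding psd_polys_eq convex_cone_iff subspace_def by blast

lemma closed_psd_polys: "closed (psd_polys A)"
  unfolding psd_polys_eq by (intro closed_Int closed_psd closed_subspace subspace_range_mat_poly)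

section \<open>The matrix exponential\<close>

lemma mat_pow_scaleR: "mat_pow (z *\<^sub>R A) k = z ^ k *\<^sub>R mat_pow A k"
  unfolding mat_pow_def
  by (induction k) (auto simp: matrix_scalar_ac scalar_matrix_assoc[symmetric])

lemma transpose_mat_pow:
  assumes "transpose A = A"
  shows "transpose (mat_pow A k) = mat_pow A k"
proof -
  have comm: "mat_pow A k ** A = A ** mat_pow A k" for k
    unfolding mat_pow_def by (induction k) (auto simp: matrix_mul_assoc[symmetric])
  show ?thesis
  proof (induction k)
    case (Suc k)
    have "mat_pow A (Suc k) = A ** mat_pow A k" by (simp add: mat_pow_def)
    then show ?case by (simp add: matrix_transpose_mul Suc assms comm)
  qed (simp add: mat_pow_def)
qed

lemma mat_pow_norm_bound:
  obtains C where "\<And>k. norm (mat_pow (A :: real^'n^'n) k) \<le> norm (mat 1 :: real^'n^'n) * C ^ k"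
proof -
  obtain K where K: "K > 0" "\<And>(A :: real^'n^'n) (B :: real^'n^'n). norm (A ** B) \<le> norm A * norm B * K"
    using bounded_bilinear.pos_bounded[OF bounded_bilinear_matrix_mult[where ?'m = 'n and ?'n = 'n and ?'k = 'n]]
    by blast
  have "norm (mat_pow A k) \<le> norm (mat 1 :: real^'n^'n) * (norm A * K) ^ k" for k
  proof (induction k)
    case (Suc k)
    have "norm (mat_pow A (Suc k)) \<le> norm A * norm (mat_pow A k) * K"
      using K(2)[of A "mat_pow A k"] by (simp add: mat_pow_def)
    also have "\<dots> \<le> norm A * (norm (mat 1 :: real^'n^'n) * (norm A * K) ^ k) * K"
      using K(1) by (intro mult_right_mono mult_left_mono Suc) auto
    finally show ?case by (simp add: mult_ac)
  qed (simp add: mat_pow_def)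
  then show thesis by (rule that)
qed

lemma mat_exp_uniform_limit:
  fixes A :: "real^'n^'n"
  shows "uniform_limit (cball 0 b) (\<lambda>n z. \<Sum>k<n. (z ^ k / fact k) *\<^sub>R mat_pow A k)
     (\<lambda>z. mat_exp (z *\<^sub>R A)) sequentially"
proof -
  obtain C where C: "\<And>k. norm (mat_pow A k) \<le> norm (mat 1 :: real^'n^'n) * C ^ k"
    using mat_pow_norm_bound by blast
  let ?M = "\<lambda>k. norm (mat 1 :: real^'n^'n) * ((\<bar>b\<bar> * C) ^ k /\<^sub>R fact k)"
  have "summable ?M" by (intro summable_mult summable_exp_generic)
  moreover have "norm ((z ^ k / fact k) *\<^sub>R mat_pow A k) \<le> ?M k" if "z \<in> cball 0 b" for z k
  proof -
    have "norm ((z ^ k / fact k) *\<^sub>R mat_pow A k) = \<bar>z\<bar> ^ k / fact k * norm (mat_pow A k)"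
      by (simp add: power_abs)
    also have "\<dots> \<le> \<bar>b\<bar> ^ k / fact k * (norm (mat 1 :: real^'n^'n) * C ^ k)"
      using that by (intro mult_mono C divide_right_mono power_mono) (auto simp: dist_norm)
    finally show ?thesis by (simp add: power_mult_distrib field_simps)
  qed
  ultimately have "uniform_limit (cball 0 b) (\<lambda>n z. \<Sum>k<n. (z ^ k / fact k) *\<^sub>R mat_pow A k)
      (\<lambda>z. \<Sum>k. (z ^ k / fact k) *\<^sub>R mat_pow A k) sequentially"
    by (intro Weierstrass_m_test)
  then show ?thesis
    by (simp add: mat_exp_def mat_pow_scaleR)
qed

lemma continuous_on_mat_exp_scaleR: "continuous_on S (\<lambda>z. mat_exp (z *\<^sub>R A))"
proof (rule continuous_at_imp_continuous_on, rule ballI)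
  fix z :: real
  have "continuous_on (cball 0 (\<bar>z\<bar> + 1)) (\<lambda>z. mat_exp (z *\<^sub>R A))"
    by (rule uniform_limit_theorem[OF _ mat_exp_uniform_limit])
      (intro always_eventually allI continuous_intros, simp_all)
  then show "isCont (\<lambda>z. mat_exp (z *\<^sub>R A)) z"
    by (rule continuous_on_interior) simp
qed

lemma mat_exp_0: "mat_exp (0 :: real^'n^'n) = mat 1"
proof -
  have "(\<lambda>k. (0 ^ k / fact k) *\<^sub>R mat_pow (mat 1 :: real^'n^'n) k) sums ((0 ^ 0 / fact 0) *\<^sub>R mat_pow (mat 1) 0)"
    using sums_finite[of "{0}" "\<lambda>k. (0 ^ k / fact k) *\<^sub>R mat_pow (mat 1 :: real^'n^'n) k"] by simp
  then have "(\<Sum>k. (0 ^ k / fact k) *\<^sub>R mat_pow (mat 1 :: real^'n^'n) k) = mat 1"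
    by (simp add: sums_unique[symmetric] mat_pow_def)
  then show ?thesis
    using mat_pow_scaleR[of 0 "mat 1 :: real^'n^'n"] by (simp add: mat_exp_def)
qed

text \<open>
  Being a polynomial in \<open>A\<close> and being symmetric both pass to the exponential in this way, since
  subspaces of a finite-dimensional space are closed.
\<close>

lemma mat_exp_in_subspace:
  assumes "subspace V" and "\<And>k. mat_pow A k \<in> V"
  shows "mat_exp (z *\<^sub>R A) \<in> V"
proof (rule closed_sequentially)
  show "closed V" by (rule closed_subspace[OF assms(1)])
  show "\<And>n. (\<Sum>k<n. (z ^ k / fact k) *\<^sub>R mat_pow A k) \<in> V"
    using assms by (intro subspace_sum subspace_scale) auto
  show "(\<lambda>n. \<Sum>k<n. (z ^ k / fact k) *\<^sub>R mat_pow A k) \<longlonglongrightarrow> mat_exp (z *\<^sub>R A)"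
    by (rule tendsto_uniform_limitI[OF mat_exp_uniform_limit[where b = "\<bar>z\<bar>"]]) simp
qed

lemma transpose_mat_exp:
  fixes A :: "real^'n^'n"
  assumes "transpose A = A"
  shows "transpose (mat_exp (z *\<^sub>R A)) = mat_exp (z *\<^sub>R A)"
proof -
  have "subspace {X :: real^'n^'n. transpose X = X}"
    by (auto simp: subspace_def linear_add[OF linear_transpose] transpose_scalar
        linear_0[OF linear_transpose])
  from mat_exp_in_subspace[OF this, of A z] show ?thesis
    using transpose_mat_pow[OF assms] by simp
qed

lemma mat_exp_in_psd_polys:
  assumes "transpose A = A" and "norm (mat_exp (z *\<^sub>R A) - mat 1) \<le> 1"
  shows "mat_exp (z *\<^sub>R A) \<in> psd_polys A"
proof -
  have "psd (mat_exp (z *\<^sub>R A))"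
    using psd_near_scaled_identity[OF transpose_mat_exp[OF assms(1)], of z 1] assms(2) by simp
  moreover have "mat_exp (z *\<^sub>R A) \<in> range (\<lambda>p. mat_poly p A)"
    by (rule mat_exp_in_subspace[OF subspace_range_mat_poly mat_pow_in_range_mat_poly])
  ultimately show ?thesis by (simp add: psd_polys_eq)
qed

section \<open>The flow near the origin\<close>

text \<open>
  The right-hand side of the equation, with \<open>b\<close> in place of \<open>a + q\<close>.
\<close>

definition flow_field :: "real \<Rightarrow> real \<Rightarrow> real^'n^'n \<Rightarrow> real \<Rightarrow> real^'n^'n \<Rightarrow> real^'n^'n" where
  "flow_field b c L t X =
     ((1 / c) * trace (Q_deriv c L X ** mat_exp ((- t * b) *\<^sub>R L))) *\<^sub>R mat_exp ((- t * b) *\<^sub>R L)"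

text \<open>
  Everything rests on the value of the scalar factor at the origin, which up to \<open>1 / c\<close> is
  \<open>Tr (Q' 0) = (c / N) * Tr L > 0\<close>. By continuity the factor stays nonnegative for small
  \<open>t\<close> and \<open>X\<close>, while the exponential, close to the identity, is a positive semidefinite
  polynomial in \<open>L\<close>; so the field takes its values in the cone \<open>psd_polys L\<close>. The Lipschitz
  constant and the bound come from those of \<open>Q_deriv c L\<close> and from the boundedness of the exponential
  on \<open>{0..1}\<close>.
\<close>

lemma flow_field_near_zero:
  fixes L :: "real^'n^'n"
  assumes "transpose L = L" and "0 < trace L" and "0 < c"
  obtains r T B M where "0 < r" and "0 < T"
    and "\<And>t. t \<in> {0..T} \<Longrightarrow> B-lipschitz_on (cball 0 r) (flow_field b c L t)"
    and "\<And>t X. t \<in> {0..T} \<Longrightarrow> X \<in> cball 0 r \<Longrightarrow> norm (flow_field b c L t X) \<le> M"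
    and "\<And>t X. t \<in> {0..T} \<Longrightarrow> X \<in> cball 0 r \<Longrightarrow> flow_field b c L t X \<in> psd_polys L"
    and "continuous_on ({0..T} \<times> cball 0 r) (\<lambda>(t, X). flow_field b c L t X)"
proof -
  define E where "E t = mat_exp ((- t * b) *\<^sub>R L)" for t
  define h where "h t X = trace (Q_deriv c L X ** E t)" for t X
  have field: "flow_field b c L t X = ((1 / c) * h t X) *\<^sub>R E t" for t X
    by (simp add: flow_field_def h_def E_def)
  have contE: "continuous_on S E" for S
    unfolding E_def
    by (rule continuous_on_compose2[OF continuous_on_mat_exp_scaleR[of UNIV]])
      (auto intro!: continuous_intros)
  have E0: "E 0 = mat 1" by (simp add: E_def mat_exp_0)
  interpret tr: bounded_bilinear "\<lambda>(A :: real^'n^'n) (B :: real^'n^'n). trace (A ** B)"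
    by (rule bounded_bilinear_trace_mult)

  obtain r0 BQ where r0: "r0 > 0" and BQ: "BQ-lipschitz_on (ball 0 r0) (Q_deriv c L)"
    using lipschitz_near_Q_deriv[of c L] unfolding lipschitz_near_def by blast
  define D where "D = {0..1 :: real} \<times> ball (0 :: real^'n^'n) r0"
  have contQ: "continuous_on D (\<lambda>p. Q_deriv c L (snd p))"
    by (rule continuous_on_compose2[OF lipschitz_on_continuous_on[OF BQ] continuous_on_snd])
      (auto simp: D_def)
  have contEp: "continuous_on D (\<lambda>p. E (fst p))"
    by (rule continuous_on_compose2[OF contE continuous_on_fst]) auto
  have conth: "continuous_on D (\<lambda>p. h (fst p) (snd p))"
    unfolding h_def by (rule tr.continuous_on[OF contQ contEp])

  have h00: "h 0 0 > 0"
  proof -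
    have "h 0 0 = c / real CARD('n) * trace L"
      by (simp add: h_def E0 Q_deriv_0 trace_def sum_distrib_left)
    then show ?thesis using assms by simp
  qed
  have "(0, 0) \<in> D" using r0 by (simp add: D_def)
  then obtain d where d: "d > 0"
    "\<And>p. p \<in> D \<Longrightarrow> dist p (0, 0) < d \<Longrightarrow> dist (h (fst p) (snd p)) (h 0 0) < h 0 0"
    using conth h00 unfolding continuous_on_iff by fastforce
  obtain e where e: "e > 0" "\<And>t. dist t 0 < e \<Longrightarrow> dist (E t) (E 0) < 1"
    using contE[of UNIV] zero_less_one[where 'a = real] unfolding continuous_on_iff by blast
  \<comment> \<open>The fractions keep \<open>cball 0 r\<close> inside the open ball of radius \<open>r0\<close> and
    \<open>\<bar>t\<bar> + norm X\<close> strictly below \<open>d\<close>.\<close>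
  define r where "r = min (r0 / 2) (d / 4)"
  define T where "T = min 1 (min (d / 4) (e / 2))"
  have r: "r > 0" "cball 0 r \<subseteq> ball (0 :: real^'n^'n) r0" and T: "T > 0" "{0..T} \<subseteq> {0..1}"
    using r0 d(1) e(1) by (auto simp: r_def T_def)
  have sub: "{0..T} \<times> cball 0 r \<subseteq> D" using r T by (auto simp: D_def)
  have h_pos: "0 \<le> h t X" if "t \<in> {0..T}" "X \<in> cball 0 r" for t X
  proof -
    have "dist (t, X) (0, 0) \<le> \<bar>t\<bar> + norm X"
      using norm_Pair_le[of t X] by (simp add: dist_norm)
    also have "\<dots> \<le> d / 4 + d / 4" using that by (intro add_mono) (auto simp: r_def T_def)
    also have "\<dots> < d" using d(1) by simp
    finally have "dist (h t X) (h 0 0) < h 0 0" using d(2)[of "(t, X)"] subsetD[OF sub, of "(t, X)"] that by simp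
    then show ?thesis by (auto simp: dist_real_def)
  qed
  have E_in: "E t \<in> psd_polys L" if "t \<in> {0..T}" for t
  proof -
    have "dist t 0 < e" using that e(1) by (auto simp: T_def dist_real_def)
    then have "norm (E t - mat 1) \<le> 1" using e(2)[of t] by (simp add: E0 dist_norm)
    then show ?thesis unfolding E_def by (rule mat_exp_in_psd_polys[OF assms(1)])
  qed

  have "bounded (E ` {0..1})"
    by (intro compact_imp_bounded compact_continuous_image contE compact_Icc)
  then obtain ME where ME: "ME > 0" "\<And>t. t \<in> {0..1} \<Longrightarrow> norm (E t) \<le> ME"
    unfolding bounded_pos by auto
  obtain K where K: "K > 0"
    "\<And>(A :: real^'n^'n) (B :: real^'n^'n). norm (trace (A ** B)) \<le> norm A * norm B * K"
    using tr.pos_bounded by blast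
  define MQ where "MQ = norm (Q_deriv c L 0) + BQ * r"
  \<comment> \<open>The field is linear in the value of \<open>Q_deriv c L\<close>, so this one estimate serves both for the
    bound and, applied to a difference of two values, for the Lipschitz constant.\<close>
  have scaled: "norm (((1 / c) * trace (A ** E t)) *\<^sub>R E t) \<le> (1 / c * (m * ME * K)) * ME"
    if "t \<in> {0..T}" "norm A \<le> m" for A :: "real^'n^'n" and t m
  proof -
    have t: "t \<in> {0..1}" using that T by auto
    have m: "0 \<le> m" using that(2) norm_ge_zero[of A] by linarith
    have "norm (trace (A ** E t)) \<le> m * ME * K"
      using K(1) ME(1) m by (intro order_trans[OF K(2)] mult_mono ME that t) auto
    then have "\<bar>1 / c\<bar> * norm (trace (A ** E t)) * norm (E t) \<le> (1 / c * (m * ME * K)) * ME"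
      using assms(3) K(1) ME(1) m by (intro mult_mono ME t) auto
    then show ?thesis by (simp add: abs_mult)
  qed
  show thesis
  proof (rule that[of r T "1 / c * (BQ * ME * K) * ME" "1 / c * (MQ * ME * K) * ME"])
    fix t assume t: "t \<in> {0..T}"
    show "(1 / c * (BQ * ME * K) * ME)-lipschitz_on (cball 0 r) (flow_field b c L t)"
    proof (rule lipschitz_onI)
      fix X Y :: "real^'n^'n" assume XY: "X \<in> cball 0 r" "Y \<in> cball 0 r"
      have "norm (Q_deriv c L X - Q_deriv c L Y) \<le> BQ * dist X Y"
        using lipschitz_onD[OF BQ subsetD[OF r(2) XY(1)] subsetD[OF r(2) XY(2)]]
        by (simp add: dist_norm)
      from scaled[OF t this]
      show "dist (flow_field b c L t X) (flow_field b c L t Y)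
          \<le> 1 / c * (BQ * ME * K) * ME * dist X Y"
        by (simp add: field h_def dist_norm tr.diff_left right_diff_distrib scaleR_left_diff_distrib mult_ac
            diff_divide_distrib)
    qed (use assms(3) K(1) ME(1) lipschitz_on_nonneg[OF BQ] in auto)
    fix X :: "real^'n^'n" assume X: "X \<in> cball 0 r"
    have "norm (Q_deriv c L X) \<le> MQ"
      unfolding MQ_def
      by (rule lipschitz_on_bounded_set_norm_bound[OF lipschitz_on_subset[OF BQ r(2)] order_refl _ X])
        (use r in auto)
    from scaled[OF t this] show "norm (flow_field b c L t X) \<le> 1 / c * (MQ * ME * K) * ME"
      by (simp add: field h_def)
    show "flow_field b c L t X \<in> psd_polys L"
      unfolding field using h_pos[OF t X] assms(3)
      by (intro convex_cone_scaleR[OF convex_cone_psd_polys] E_in t) auto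
  next
    have "continuous_on D (\<lambda>p. flow_field b c L (fst p) (snd p))"
      unfolding field by (intro continuous_intros conth contEp)
    then show "continuous_on ({0..T} \<times> cball 0 r) (\<lambda>(t, X). flow_field b c L t X)"
      unfolding case_prod_beta' using sub by (rule continuous_on_subset)
  qed (fact r(1) T(1))+
qed

text \<open>
  The two parts use different sets. Uniqueness is proved in a ball of radius \<open>r\<close>, which contains
  the Loewner interval of all competitors because \<open>N\<^sup>2 * x0 = r\<close>. Existence is proved in the smaller
  set \<open>psd_polys L \<inter> cball 0 x0\<close>, on which the Loewner bounds hold: the Picard iterates are
  integrals of cone-valued functions, hence in the cone, and they stay in the ball because
  \<open>M * t0 \<le> x0\<close>.
\<close>

theorem local_wellposedness_symmetric:
  fixes L :: "real^'n^'n"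
  assumes sym: "transpose L = L" and tr: "0 < trace L" and c: "0 < c"
  shows "\<exists>t0 > 0. \<exists>x0 > 0.
           (\<exists>R. is_solution L a q c t0 x0 R) \<and>
           (\<forall>R S. is_solution L a q c t0 x0 R \<longrightarrow> is_solution L a q c t0 x0 S \<longrightarrow>
                  (\<forall>t\<in>{0..t0}. R t = S t))"
proof -
  let ?F = "flow_field (a + q) c L"
  obtain r T B M where r: "0 < r" and T: "0 < T"
    and lip: "\<And>t. t \<in> {0..T} \<Longrightarrow> B-lipschitz_on (cball 0 r) (?F t)"
    and bound: "\<And>t X. t \<in> {0..T} \<Longrightarrow> X \<in> cball 0 r \<Longrightarrow> norm (?F t X) \<le> M"
    and cone: "\<And>t X. t \<in> {0..T} \<Longrightarrow> X \<in> cball 0 r \<Longrightarrow> ?F t X \<in> psd_polys L"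
    and cont: "continuous_on ({0..T} \<times> cball 0 r) (\<lambda>(t, X). ?F t X)"
    by (rule flow_field_near_zero[OF sym tr c, of "a + q"]) (rule that)
  have B0: "0 \<le> B" using lip[of 0] T lipschitz_on_nonneg by auto
  have "norm (?F 0 0) \<le> M" by (rule bound) (use T r in auto)
  then have M0: "0 \<le> M" by (rule order_trans[OF norm_ge_zero])
  \<comment> \<open>The three bounds on \<open>t0\<close> serve, in this order, the estimates on the field, the invariance
    of the ball of radius \<open>x0\<close>, and the contraction. The added 1 allows for \<open>M = 0\<close> and
    \<open>B = 0\<close>, and in the last bound it makes \<open>t0 * B < 1\<close> strict.\<close>
  define x0 where "x0 = r / (real CARD('n))\<^sup>2"
  define t0 where "t0 = min T (min (x0 / (M + 1)) (1 / (B + 1)))"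
  have x0: "0 < x0" "(real CARD('n))\<^sup>2 * x0 = r" "x0 \<le> r"
    using r by (auto simp: x0_def divide_le_eq_1 field_simps)
  have t0: "0 < t0" "{0..t0} \<subseteq> {0..T}" using T x0(1) M0 B0 by (auto simp: t0_def)
  have "t0 \<le> x0 / (M + 1)" "t0 \<le> 1 / (B + 1)" by (auto simp: t0_def)
  then have "t0 * (M + 1) \<le> x0" "t0 * (B + 1) \<le> 1"
    using M0 B0 pos_le_divide_eq[of "M + 1" t0 x0] pos_le_divide_eq[of "B + 1" t0 1] by auto
  then have t0M: "M * t0 \<le> x0" and t0B: "t0 * B < 1"
    using t0(1) by (auto simp: algebra_simps)
  have uniq: "R t = S t" if R: "is_solution L a q c t0 x0 R" and S: "is_solution L a q c t0 x0 S"
    and t: "t \<in> {0..t0}" for R S t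
  proof (rule picard_uniqueness[where T = t0 and K = "cball 0 r" and F = ?F and B = B])
    have sol: "X t \<in> cball 0 r \<and> (X has_vector_derivative ?F t (X t)) (at t within {0..t0})"
      if "is_solution L a q c t0 x0 X" "t \<in> {0..t0}" for X t
      using that loewner_interval_norm_bound[of "X t" x0] x0(2)
      by (auto simp: is_solution_def flow_field_def)
    show "\<And>t. t \<in> {0..t0} \<Longrightarrow> R t \<in> cball 0 r \<and>
        (R has_vector_derivative ?F t (R t)) (at t within {0..t0})" by (rule sol[OF R])
    show "\<And>t. t \<in> {0..t0} \<Longrightarrow> S t \<in> cball 0 r \<and>
        (S has_vector_derivative ?F t (S t)) (at t within {0..t0})" by (rule sol[OF S])
    show "R 0 = S 0" using R S by (simp add: is_solution_def)
    show "\<And>t. t \<in> {0..t0} \<Longrightarrow> B-lipschitz_on (cball 0 r) (?F t)" using lip t0(2) by blast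
  qed (use t0 t0B t in auto)
  define K where "K = psd_polys L \<inter> cball 0 x0"
  have K: "K \<subseteq> cball 0 r" using x0(3) by (auto simp: K_def)
  have contK: "continuous_on ({0..t0} \<times> K) (\<lambda>(t, X). ?F t X)"
    using cont by (rule continuous_on_subset) (use K t0 in auto)
  have "\<exists>R. R 0 = 0 \<and> R ` {0..t0} \<subseteq> K \<and>
      (\<forall>t\<in>{0..t0}. (R has_vector_derivative ?F t (R t)) (at t within {0..t0}))"
  proof (rule picard_existence[where B = B])
    show "0 \<le> t0" "t0 * B < 1" using t0 t0B by auto
    show "closed K" unfolding K_def by (intro closed_Int closed_psd_polys closed_cball)
    show "0 \<in> K" using convex_cone_psd_polys[of L] x0(1) by (simp add: K_def convex_cone_iff)
    show "continuous_on ({0..t0} \<times> K) (\<lambda>(t, X). ?F t X)" by (rule contK)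
    show "B-lipschitz_on K (?F t)" if "t \<in> {0..t0}" for t
      using lip K t0(2) that by (blast intro: lipschitz_on_subset)
    fix R t assume R: "continuous_on {0..t0} R" "R ` {0..t0} \<subseteq> K" and t: "t \<in> {0..t0}"
    have "continuous_on {0..t0} (\<lambda>s. (s, R s))" using R(1) by (intro continuous_intros)
    from continuous_on_compose2[OF contK this] R(2)
    have "continuous_on {0..t0} (\<lambda>s. ?F s (R s))" by auto
    then have c: "continuous_on {0..t} (\<lambda>s. ?F s (R s))"
      by (rule continuous_on_subset) (use t in auto)
    have s: "s \<in> {0..T}" "R s \<in> cball 0 r" if "s \<in> {0..t}" for s
    proof -
      have "s \<in> {0..t0}" using that t by auto
      then show "s \<in> {0..T}" "R s \<in> cball 0 r" using t0(2) R(2) K by blast+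
    qed
    have "norm (integral {0..t} (\<lambda>s. ?F s (R s))) \<le> M * (t - 0)"
      using t by (intro integral_bound c bound s) auto
    also have "\<dots> \<le> M * t0" using t M0 by (intro mult_left_mono) auto
    finally have "norm (integral {0..t} (\<lambda>s. ?F s (R s))) \<le> x0" using t0M by linarith
    moreover have "integral {0..t} (\<lambda>s. ?F s (R s)) \<in> psd_polys L"
      by (intro integral_in_closed_convex_cone convex_cone_psd_polys closed_psd_polys
          integrable_continuous_real c cone s)
    ultimately show "integral {0..t} (\<lambda>s. ?F s (R s)) \<in> K" by (simp add: K_def)
  qed
  then obtain R where R: "R 0 = 0" "\<And>t. t \<in> {0..t0} \<Longrightarrow> R t \<in> K"
    "\<And>t. t \<in> {0..t0} \<Longrightarrow> (R has_vector_derivative ?F t (R t)) (at t within {0..t0})"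
    by blast
  have "loewner_le 0 X \<and> loewner_le X (x0 *\<^sub>R mat 1)" if "X \<in> K" for X
  proof -
    have X: "psd X" "transpose X = X" "norm X \<le> x0"
      using that by (auto simp: K_def psd_polys_def psd_def)
    have "transpose (x0 *\<^sub>R mat 1 - X) = x0 *\<^sub>R mat 1 - X"
      by (simp add: linear_diff[OF linear_transpose] transpose_scalar X)
    then have "psd (x0 *\<^sub>R mat 1 - X)" by (rule psd_near_scaled_identity[where s = x0]) (simp add: X)
    then show ?thesis using X by (simp add: loewner_le_def)
  qed
  then have "is_solution L a q c t0 x0 R"
    using R unfolding is_solution_def flow_field_def K_def by blast
  then show ?thesis using t0(1) x0(1) uniq by blast
qed

section \<open>The normalized Laplacian\<close>

lemma transpose_normalized_laplacian:
  assumes "symp E"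
  shows "transpose (normalized_laplacian E) = normalized_laplacian E"
  using assms by (auto simp: normalized_laplacian_def transpose_def vec_eq_iff mult.commute dest: sympD)

lemma trace_normalized_laplacian:
  "trace (normalized_laplacian (E :: 'n::finite \<Rightarrow> 'n \<Rightarrow> bool)) = real CARD('n)"
  by (simp add: trace_def normalized_laplacian_def)

theorem theorem4p6:
  fixes E :: "'n::finite \<Rightarrow> 'n \<Rightarrow> bool" and a q c :: real
  assumes "simple_graph E" and "graph_connected E" and "vertex_transitive E"
    and "a \<ge> 0" and "q \<ge> 0" and "c > 0"
  shows "\<exists>t0 > 0. \<exists>x0 > 0.
           (\<exists>R. is_solution (normalized_laplacian E) a q c t0 x0 R) \<and>
           (\<forall>R S. is_solution (normalized_laplacian E) a q c t0 x0 R \<longrightarrow>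
                  is_solution (normalized_laplacian E) a q c t0 x0 S \<longrightarrow>
                  (\<forall>t\<in>{0..t0}. R t = S t))"
proof (rule local_wellposedness_symmetric)
  show "transpose (normalized_laplacian E) = normalized_laplacian E"
    using assms(1) by (intro transpose_normalized_laplacian) (simp add: simple_graph_def)
  show "0 < trace (normalized_laplacian E)" by (simp add: trace_normalized_laplacian)
qed (rule assms(6))

end
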